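(* Let $D>0$, $\eta\in(0,D/2)$, $\theta\in(0,\pi/2)$, let $\mathbf{x}_0=(x_0,y_0,z_0)\in\mathbb{R}^3$, let $S(\mathbf{x}_0,\theta,D)$ be the disk of diameter $D$ centered at $\mathbf{x}_0$ in the plane $\{z=z_0\}$, and let $m$ be the smooth cut-off function described in the context. Then for every point $\mathbf{x}=(x,y,z)\in\mathbb{R}^3$ the following asymptotic formula is valid as $k\to\infty$: $$\int_{S(\mathbf{x}_0,\theta,D)}\frac{\exp\left(\mathrm{i}k\sqrt{(x-\xi_1)^2+(y-\xi_2)^2+(z-z_0)^2}\right)}{4\pi\sqrt{(x-\xi_1)^2+(y-\xi_2)^2+(z-z_0)^2}}\,m(\eta,\theta,\boldsymbol{\xi},\mathbf{x}_0,D)\,d\xi_1 d\xi_2$$ $$=\begin{cases}\dfrac{\mathrm{i}}{2k}e^{\mathrm{i}k|z-z_0|}\left[m(\eta,\theta,(x,y,z_0),\mathbf{x}_0,D)+\mathcal{O}(1/k)\right] & \text{if }(x,y)\in S(\mathbf{x}_0,\theta,D),\\[2mm] \mathcal{O}(1/k^2) & \text{if }(x,y)\notin S(\mathbf{x}_0,\theta,D),\end{cases}$$ where $\boldsymbol{\xi}=(\xi_1,\xi_2,z_0)$.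
   Context: Coordinates $(x,y,z)$ in $\mathbb{R}^3$ are the rotated ones, in which the central line of the antenna (orthogonal to the antenna disk and passing through its center $\mathbf{x}_0$) is parallel to the $z$-axis; $\theta$ is the elevation angle of the antenna, which enters only through this rotation. The disk is $S(\mathbf{x}_0,\theta,D)=\{(\xi_1,\xi_2,z_0): (\xi_1-x_0)^2+(\xi_2-y_0)^2<D^2/4\}$, and $(x,y)\in S(\mathbf{x}_0,\theta,D)$ means $(x,y,z_0)\in S(\mathbf{x}_0,\theta,D)$. The function $\mathbf{x}\mapsto m(\eta,\theta,\mathbf{x},\mathbf{x}_0,D)$ is a smooth ($C^\infty$) function on $\mathbb{R}^3$ with values in $[0,1]$ such that $m=1$ for $|\mathbf{x}-\mathbf{x}_0|<D/2-\eta$, $m=0$ for $|\mathbf{x}-\mathbf{x}_0|\ge D/2$, and $m\in[0,1]$ for $D/2-\eta\le|\mathbf{x}-\mathbf{x}_0|<D/2$. Here $\mathrm{i}=\sqrt{-1}$ and $k>0$ is the wavenumber. The $\mathcal{O}$ terms are for $k\to\infty$ with all other quantities (including $\mathbf{x}$) fixed. *)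

theory Defs
  imports "HOL-Analysis.Analysis" "HOL-Library.Landau_Symbols"
begin

(* C^n on the whole space: the recursion goes through all directional derivatives
   x |-> f'(x) v of the Frechet derivative, so that Ck_function n f says that f is n times
   differentiable and that all mixed directional derivatives of order at most n are continuous. *)
primrec Ck_function :: "nat \<Rightarrow> ('a::real_normed_vector \<Rightarrow> 'b::real_normed_vector) \<Rightarrow> bool" where
  "Ck_function 0 f \<longleftrightarrow> continuous_on UNIV f"
| "Ck_function (Suc n) f \<longleftrightarrow>
     (\<forall>x. f differentiable (at x)) \<and>
     (\<forall>v. Ck_function n (\<lambda>x. frechet_derivative f (at x) v))"

definition smooth_function :: "('a::real_normed_vector \<Rightarrow> 'b::real_normed_vector) \<Rightarrow> bool" where
  "smooth_function f \<longleftrightarrow> (\<forall>n. Ck_function n f)"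

(* The disk in the rotated coordinates. The elevation angle \<theta> only enters through the choice
   of these coordinates, hence it does not occur on the right-hand side. *)
definition antenna_disk :: "real^3 \<Rightarrow> real \<Rightarrow> real \<Rightarrow> (real^3) set" where
  "antenna_disk p0 \<theta> D =
     {\<xi>. (\<xi>$1 - p0$1)\<^sup>2 + (\<xi>$2 - p0$2)\<^sup>2 < D\<^sup>2 / 4 \<and> \<xi>$3 = p0$3}"

(* The properties required of p |-> m(\<eta>, \<theta>, p, p0, D). *)
definition antenna_cutoff :: "real \<Rightarrow> real^3 \<Rightarrow> real \<Rightarrow> (real^3 \<Rightarrow> real) \<Rightarrow> bool" where
  "antenna_cutoff \<eta> p0 D \<mu> \<longleftrightarrow>
     smooth_function \<mu> \<and>
     (\<forall>p. \<mu> p \<in> {0..1}) \<and>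
     (\<forall>p. norm (p - p0) < D / 2 - \<eta> \<longrightarrow> \<mu> p = 1) \<and>
     (\<forall>p. norm (p - p0) \<ge> D / 2 \<longrightarrow> \<mu> p = 0)"

(* At r = 0, which happens for at most one point of the disk, division by zero gives the value 0. *)
definition spherical_wave :: "real \<Rightarrow> real \<Rightarrow> complex" where
  "spherical_wave k r = exp (\<i> * of_real (k * r)) / of_real (4 * pi * r)"

end

theory Submission
  imports Defs "HOL-Probability.Sinc_Integral"
begin

text \<open>
Write \<open>h = z - z0\<close> and let \<open>r\<close> be the distance in the antenna plane from the projection
\<open>(x, y)\<close> of the observation point. In polar coordinates around \<open>(x, y)\<close> the Jacobian \<open>r\<close> turns
the kernel into \<open>r / R * exp (\<i> k R)\<close> with \<open>R = sqrt (r\<^sup>2 + h\<^sup>2)\<close>, and this is the exact derivative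
of \<open>exp (\<i> k R) / (\<i> k)\<close>. So there is no singularity left, and integrating by parts in \<open>r\<close> yields
the boundary term at \<open>r = 0\<close>, which is the value of the cut-off at \<open>(x, y)\<close> times
\<open>\<i> / k * exp (\<i> k \<bar>h\<bar>)\<close>. The other end contributes nothing because the cut-off has bounded
support.

A second integration by parts shows that the rest is \<open>O(1 / k\<^sup>2)\<close>. It needs the quotient
\<open>F' r / r\<close> of the radial profile \<open>F\<close> to be bounded with bounded derivative, which is true if
\<open>F\<close> has three derivatives and \<open>F' 0 = 0\<close> (lemma \<open>radial_stationary_phase\<close>). The condition
\<open>F' 0 = 0\<close> can fail for a single ray but holds for the sum of two opposite rays. Therefore whole
lines through \<open>(x, y)\<close> are used instead of rays (lemma \<open>full_line_stationary_phase\<close>), and no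
derivative of an angular average is ever taken. The estimate is uniform in the direction of
the line, since the directional derivatives of order at most three are combinations of
finitely many continuous functions with coefficients bounded by one (lemma
\<open>Ck_function_along_lines\<close>).

The lines are parametrized by their slope \<open>s\<close> rather than by their angle. The formula for
integration in these coordinates (lemma \<open>lborel_eq_distr_slope_polar\<close>) then follows from
Tonelli's theorem and one-dimensional affine substitutions; the angular measure becomes
\<open>ds / (1 + s\<^sup>2)\<close>, of total mass \<open>pi\<close>. Averaging over \<open>s\<close> gives one expansion with leading term
\<open>\<i> / (2 k) * exp (\<i> k \<bar>h\<bar>) * m\<close> for every \<open>(x, y)\<close> (lemma \<open>plane_stationary_phase\<close>), and both cases
of the theorem are read off from it, as \<open>m = 0\<close> outside the disk.
\<close>

section \<open>Stationary phase along a line\<close>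

text \<open>
Two integrations by parts. The second one divides \<open>F1\<close> by the derivative \<open>r / R r\<close> of \<open>R\<close>. For
\<open>h \<noteq> 0\<close> that derivative vanishes at \<open>r = 0\<close>, the stationary point of the phase, and the quotient
stays bounded because \<open>F1 0 = 0\<close>. The error constant is explicit and depends on \<open>F\<close> only through
\<open>M\<close>, so that the estimate is uniform over families of profiles.
\<close>

lemma radial_stationary_phase:
  fixes F F1 F2 F3 :: "real \<Rightarrow> real" and h k L M :: real
  defines "R \<equiv> (\<lambda>r. sqrt (r\<^sup>2 + h\<^sup>2))"
  assumes L: "L > 0" and k: "k > 0"
    and dF: "\<And>r. (F has_real_derivative F1 r) (at r)"
    and dF1: "\<And>r. (F1 has_real_derivative F2 r) (at r)"
    and dF2: "\<And>r. (F2 has_real_derivative F3 r) (at r)"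
    and F1_0: "F1 0 = 0" and FL: "F L = 0"
    and M2: "\<And>r. r \<in> {0..L} \<Longrightarrow> \<bar>F2 r\<bar> \<le> M"
    and M3: "\<And>r. r \<in> {0..L} \<Longrightarrow> \<bar>F3 r\<bar> \<le> M"
  shows "\<exists>J. ((\<lambda>r. of_real (r * F r / R r) * exp (\<i> * of_real (k * R r))) has_integral J) {0..L} \<and>
    norm (J - \<i> / of_real k * exp (\<i> * of_real (k * \<bar>h\<bar>)) * of_real (F 0))
      \<le> M * (2 * R L + L * (1 + R L)) / k\<^sup>2"
proof -
  define e where "e = (\<lambda>r. exp (\<i> * of_real (k * R r)))"
  define Q where "Q = (\<lambda>r. if r = 0 then F2 0 else F1 r / r)"
  define Q' where "Q' = (\<lambda>r. (r * F2 r - F1 r) / r\<^sup>2)"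
  \<comment> \<open>\<open>W'\<close> is the derivative of \<open>R Q\<close> on \<open>r > 0\<close>. Its value at \<open>0\<close>, where \<open>R\<close> has a corner if \<open>h = 0\<close>,
    is set to \<open>0\<close>, as the fundamental theorem of calculus only uses interior derivatives.\<close>
  define W' where "W' = (\<lambda>r. if r = 0 then 0 else r / R r * Q r + R r * Q' r)"
  have M0: "M \<ge> 0" using M2[of 0] L by auto
  have Rpos: "R r > 0" if "r > 0" for r
    using that by (auto simp: R_def intro!: add_pos_nonneg)
  have R0: "R 0 = \<bar>h\<bar>" by (simp add: R_def)
  have Rge: "R r \<ge> \<bar>r\<bar>" for r unfolding R_def by (rule real_le_rsqrt) auto
  have Rmono: "R r \<le> R L" if "0 \<le> r" "r \<le> L" for r
    using that by (auto simp: R_def power2_le_iff_abs_le)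
  have Rnn: "R r \<ge> 0" for r by (simp add: R_def)
  have dR: "(R has_real_derivative r / R r) (at r)" if "r > 0" for r
    unfolding R_def using that Rpos[OF that]
    by (auto intro!: derivative_eq_intros simp: R_def field_simps)
  have contR: "continuous_on S R" for S unfolding R_def by (intro continuous_intros)
  have conte: "continuous_on S e" for S unfolding e_def by (intro continuous_intros contR)
  have ne: "norm (e r) = 1" for r by (simp add: e_def)
  have contF: "continuous_on S F" "continuous_on S F1" for S
    by (rule continuous_at_imp_continuous_on, blast intro: DERIV_isCont dF dF1)+
  have de: "(e has_vector_derivative (\<i> * of_real (k * (r / R r)) * e r)) (at r)" if "r > 0" for r
  proof -
    have 1: "((\<lambda>r. \<i> * of_real (k * R r)) has_vector_derivative (\<i> * of_real (k * (r / R r)))) (at r)"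
      by (intro derivative_intros has_vector_derivative_mult_right)
         (use DERIV_cmult[OF dR[OF that], of k] in \<open>simp add: has_real_derivative_iff_has_vector_derivative\<close>)
    show ?thesis
      using field_vector_diff_chain_at[OF 1 DERIV_exp]
      unfolding e_def o_def by (simp add: mult.commute)
  qed
  \<comment> \<open>Both quotients are controlled by the mean value theorem, starting from \<open>F1 0 = 0\<close>.\<close>
  have F1_bd: "\<bar>F1 r\<bar> \<le> M * r" and Q'_bd: "\<bar>Q' r\<bar> \<le> M" if r: "0 < r" "r \<le> L" for r
  proof -
    obtain c where c: "0 < c" "c < r" "F1 r - F1 0 = (r - 0) * F2 c"
      using MVT2[of 0 r F1 F2] r dF1 by auto
    then have F1r: "F1 r = r * F2 c" by (simp add: F1_0)
    show "\<bar>F1 r\<bar> \<le> M * r"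
      using M2[of c] c r by (simp add: F1r abs_mult mult.commute)
    obtain d where d: "c < d" "d < r" "F2 r - F2 c = (r - c) * F3 d"
      using MVT2[of c r F2 F3] c dF2 by auto
    have "\<bar>F2 r - F2 c\<bar> \<le> r * M"
      unfolding d(3) abs_mult using c d r M3[of d] by (intro mult_mono) auto
    moreover have "Q' r = (F2 r - F2 c) / r"
      using r by (simp add: Q'_def F1r power2_eq_square right_diff_distrib[symmetric])
    ultimately show "\<bar>Q' r\<bar> \<le> M"
      using r by (simp add: divide_le_eq mult.commute)
  qed
  have Q_bd: "\<bar>Q r\<bar> \<le> M" if "0 \<le> r" "r \<le> L" for r
    using that F1_bd[of r] M2[of 0] L by (auto simp: Q_def divide_le_eq)
  have dQ: "(Q has_real_derivative Q' r) (at r)" if "r > 0" for r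
  proof -
    have "((\<lambda>r. F1 r / r) has_real_derivative Q' r) (at r)"
      unfolding Q'_def using that dF1
      by (auto intro!: derivative_eq_intros simp: power2_eq_square mult.commute)
    then show ?thesis
      by (rule has_field_derivative_transform_within_open[where S="{0<..}"]) (use that in \<open>auto simp: Q_def\<close>)
  qed
  have contQ: "continuous_on {0..L} Q"
  proof -
    have "isCont Q r" if "r \<ge> 0" for r
    proof (cases "r = 0")
      case True
      have "((\<lambda>r. F1 r / r) \<longlongrightarrow> F2 0) (at 0)"
        using dF1[of 0] F1_0 by (simp add: has_field_derivative_def field_has_derivative_at DERIV_def)
      then have "(Q \<longlongrightarrow> F2 0) (at 0)"
        by (rule Lim_transform_eventually) (auto simp: Q_def eventually_at_filter)
      then show ?thesis by (simp add: True isCont_def Q_def)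
    next
      case False
      with that show ?thesis using dQ[of r] by (auto intro: DERIV_isCont)
    qed
    then show ?thesis by (auto intro: continuous_at_imp_continuous_on)
  qed
  have deriv_mult_e: "((\<lambda>r. of_real (f r) * e r) has_vector_derivative
      (of_real f' * e r + of_real (f r) * (\<i> * of_real (k * (r / R r)) * e r))) (at r)"
    if "(f has_real_derivative f') (at r)" "r > 0" for f f' r
  proof -
    have "((\<lambda>r. complex_of_real (f r)) has_vector_derivative of_real f') (at r)"
      using that by (intro has_vector_derivative_of_real) (simp add: has_real_derivative_iff_has_vector_derivative)
    from has_vector_derivative_mult[OF this de[OF that(2)]] show ?thesis
      by (simp add: add.commute)
  qed
  \<comment> \<open>As \<open>e' = \<i> k (r / R) e\<close>, the derivative of \<open>F e\<close> is \<open>\<i> k\<close> times the integrand plus \<open>F1 e\<close>.\<close>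
  have i1: "((\<lambda>r. \<i> * of_real k * (of_real (r * F r / R r) * e r) + of_real (F1 r) * e r)
      has_integral (of_real (F L) * e L - of_real (F 0) * e 0)) {0..L}"
  proof (rule fundamental_theorem_of_calculus_interior)
    show "continuous_on {0..L} (\<lambda>r. of_real (F r) * e r)"
      by (intro continuous_intros contF conte)
    fix r assume "r \<in> {0<..<L}"
    then show "((\<lambda>r. of_real (F r) * e r) has_vector_derivative
       (\<i> * of_real k * (of_real (r * F r / R r) * e r) + of_real (F1 r) * e r)) (at r)"
      using deriv_mult_e[OF dF, of r] by (simp add: algebra_simps)
  qed (use L in auto)
  \<comment> \<open>The same step for \<open>F1 e\<close>, whose primitive up to a bounded remainder \<open>W' e\<close> is \<open>R Q e / (\<i> k)\<close>.\<close>
  have i2: "((\<lambda>r. \<i> * of_real k * (of_real (F1 r) * e r) + of_real (W' r) * e r)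
      has_integral (of_real (R L * Q L) * e L - of_real (R 0 * Q 0) * e 0)) {0..L}"
  proof (rule fundamental_theorem_of_calculus_interior)
    show "continuous_on {0..L} (\<lambda>r. of_real (R r * Q r) * e r)"
      by (intro continuous_intros contR contQ conte)
    fix r assume r: "r \<in> {0<..<L}"
    have 1: "((\<lambda>r. R r * Q r) has_real_derivative W' r) (at r)"
      using r by (auto intro!: derivative_eq_intros dR dQ simp: W'_def)
    have 2: "of_real (R r * Q r) * of_real (r / R r) = complex_of_real (F1 r)"
      using r Rpos[of r] by (simp add: Q_def flip: of_real_mult of_real_divide)
    show "((\<lambda>r. of_real (R r * Q r) * e r) has_vector_derivative
       (\<i> * of_real k * (of_real (F1 r) * e r) + of_real (W' r) * e r)) (at r)"
      unfolding 2[symmetric] using r Rpos[of r] deriv_mult_e[OF 1] by (simp add: algebra_simps)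
  qed (use L in auto)
  obtain A where A: "((\<lambda>r. of_real (F1 r) * e r) has_integral A) {0..L}"
  proof -
    have "continuous_on {0..L} (\<lambda>r. of_real (F1 r) * e r)"
      by (intro continuous_intros contF conte)
    from integrable_continuous_real[OF this] show ?thesis
      using that by (auto simp: integrable_on_def)
  qed
  define B where "B = of_real (R L * Q L) * e L - of_real (R 0 * Q 0) * e 0 - \<i> * of_real k * A"
  have B: "((\<lambda>r. of_real (W' r) * e r) has_integral B) {0..L}"
    using has_integral_diff[OF i2 has_integral_mult_right[OF A, of "\<i> * of_real k"]]
    by (simp add: B_def)
  have "norm B \<le> (M + R L * M) * measure lborel {0..L}"
  proof (rule has_integral_bound_real[OF _ finite.emptyI])
    show "((\<lambda>r. of_real (W' r) * e r) has_integral B) {0..L}" by (rule B)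
    show "0 \<le> M + R L * M" using M0 Rnn by auto
    fix r assume r: "r \<in> {0..L} - {}"
    have "\<bar>r / R r * Q r + R r * Q' r\<bar> \<le> 1 * M + R L * M" if "r > 0"
    proof (intro abs_triangle_ineq[THEN order_trans] add_mono)
      show "\<bar>r / R r * Q r\<bar> \<le> 1 * M"
        unfolding abs_mult using r that Rge[of r] Rpos[of r] Q_bd[of r] by (intro mult_mono) auto
      show "\<bar>R r * Q' r\<bar> \<le> R L * M"
        unfolding abs_mult using r that Rnn Q'_bd[of r] Rmono[of r] by (intro mult_mono) auto
    qed
    then show "norm (of_real (W' r) * e r) \<le> M + R L * M"
      using r M0 Rnn by (auto simp: norm_mult ne W'_def)
  qed
  moreover have "norm (of_real (R L * Q L) * e L) \<le> R L * M" "norm (of_real (R 0 * Q 0) * e 0) \<le> R L * M"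
    using Q_bd[of L] Q_bd[of 0] Rmono[of 0] L Rnn
    by (auto simp: norm_mult ne abs_mult intro!: mult_mono)
  moreover have "k * norm A \<le> norm (of_real (R L * Q L) * e L) + norm (of_real (R 0 * Q 0) * e 0) + norm B"
  proof -
    have "k * norm A = norm (\<i> * of_real k * A)"
      using k by (simp add: norm_mult)
    also have "\<i> * of_real k * A = of_real (R L * Q L) * e L - of_real (R 0 * Q 0) * e 0 - B"
      by (simp add: B_def)
    also have "norm \<dots> \<le> norm (of_real (R L * Q L) * e L - of_real (R 0 * Q 0) * e 0) + norm B"
      by (rule norm_triangle_ineq4)
    also have "\<dots> \<le> norm (of_real (R L * Q L) * e L) + norm (of_real (R 0 * Q 0) * e 0) + norm B"
      by (intro add_right_mono norm_triangle_ineq4)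
    finally show ?thesis .
  qed
  ultimately have A_bd: "k * norm A \<le> M * (2 * R L + L * (1 + R L))"
    using L by (simp add: algebra_simps)
  define J where "J = (- of_real (F 0) * e 0 - A) / (\<i> * of_real k)"
  have "((\<lambda>r. \<i> * of_real k * (of_real (r * F r / R r) * e r)) has_integral (- of_real (F 0) * e 0 - A)) {0..L}"
    using has_integral_diff[OF i1 A] by (simp add: FL)
  from has_integral_divide[OF this, of "\<i> * of_real k"]
  have "((\<lambda>r. of_real (r * F r / R r) * e r) has_integral J) {0..L}"
    using k by (simp add: J_def)
  moreover have "J - \<i> / of_real k * e 0 * of_real (F 0) = \<i> / of_real k * A"
    using k by (simp add: J_def field_simps)
  then have "norm (J - \<i> / of_real k * e 0 * of_real (F 0)) = k * norm A / k\<^sup>2"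
    using k by (simp add: norm_mult norm_divide power2_eq_square)
  ultimately show ?thesis
    using A_bd k by (intro exI[of _ J]) (auto simp: e_def R0 divide_right_mono)
qed

text \<open>
The integral over the negative half of the line is folded onto the positive half. This
replaces the amplitude by its even part, whose first derivative vanishes at the origin for any
\<open>f 0\<close>. The pointwise bound on \<open>q\<close> holds because \<open>\<bar>r\<bar> \<le> R r\<close>, also if \<open>h = 0\<close>.
\<close>

lemma full_line_stationary_phase:
  fixes f :: "nat \<Rightarrow> real \<Rightarrow> real" and h k L M :: real
  defines "R \<equiv> (\<lambda>r. sqrt (r\<^sup>2 + h\<^sup>2))"
  defines "q \<equiv> (\<lambda>r. \<bar>r\<bar> *\<^sub>R (spherical_wave k (R r) * of_real (f 0 r)))"
  assumes L: "L > 0" and k: "k > 0"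
    and df: "\<And>i r. i < 3 \<Longrightarrow> (f i has_real_derivative f (Suc i) r) (at r)"
    and M: "\<And>i r. i \<le> 3 \<Longrightarrow> \<bar>r\<bar> \<le> L \<Longrightarrow> \<bar>f i r\<bar> \<le> M"
    and f_L: "\<And>r. L \<le> \<bar>r\<bar> \<Longrightarrow> f 0 r = 0"
  shows "norm (q r) \<le> M * indicator {-L..L} r"
    and "integrable lborel q"
    and "norm (integral\<^sup>L lborel q - \<i> / of_real (2 * pi * k) * exp (\<i> * of_real (k * \<bar>h\<bar>)) * of_real (f 0 0))
      \<le> M * (2 * R L + L * (1 + R L)) / k\<^sup>2"
proof -
  have Rge: "R r \<ge> \<bar>r\<bar>" for r unfolding R_def by (rule real_le_rsqrt) auto
  have M0: "M \<ge> 0" using M[of 0 0] L by auto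
  have [measurable]: "f 0 \<in> borel_measurable borel"
    using df[of 0] by (intro borel_measurable_continuous_onI continuous_at_imp_continuous_on) (auto intro: DERIV_isCont)
  have [measurable]: "q \<in> borel_measurable borel"
    unfolding q_def spherical_wave_def R_def by measurable
  show q_bound: "norm (q r) \<le> M * indicator {-L..L} r" for r
  proof (cases "\<bar>r\<bar> \<le> L")
    case True
    have "norm (q r) = (\<bar>r\<bar> / R r / (4 * pi)) * \<bar>f 0 r\<bar>"
      using Rge[of r] by (simp add: q_def spherical_wave_def norm_mult norm_divide)
    also have "\<dots> \<le> 1 * M"
    proof (intro mult_mono)
      have "t / (4 * pi) \<le> 1" if "t \<le> 1" for t :: real
        using that pi_ge_two by (simp add: divide_le_eq)
      moreover have "\<bar>r\<bar> / R r \<le> 1" using Rge[of r] by (auto simp: divide_le_eq_1)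
      ultimately show "\<bar>r\<bar> / R r / (4 * pi) \<le> 1" by blast
    qed (use M[of 0 r] True M0 in auto)
    finally show ?thesis using True by (simp add: indicator_def abs_le_iff)
  next
    case False
    then show ?thesis using f_L[of r] M0 by (auto simp: q_def)
  qed
  show int_q: "integrable lborel q"
  proof (rule Bochner_Integration.integrable_bound)
    show "integrable lborel (\<lambda>r. M * indicator {-L..L} r :: real)"
      by (intro integrable_mult_right integrable_real_indicator) (auto simp: emeasure_lborel_Icc_eq)
    show "AE r in lborel. norm (q r) \<le> norm (M * indicator {-L..L} r)"
      using q_bound M0 by (auto simp: abs_mult)
  qed simp
  \<comment> \<open>The factor \<open>4 * pi\<close> of the spherical wave is absorbed into the even part; \<open>F i\<close> is the
    \<open>i\<close>-th derivative of \<open>F 0\<close>, hence the alternating sign, which gives \<open>F 1 0 = 0\<close>.\<close>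
  define F where "F = (\<lambda>i r. (f i r + (-1) ^ i * f i (- r)) / (4 * pi))"
  have dF: "(F i has_real_derivative F (Suc i) r) (at r)" if "i < 3" for i r
  proof -
    have "((\<lambda>r. f i (- r)) has_real_derivative f (Suc i) (- r) * (- 1)) (at r)"
      by (rule DERIV_chain2[OF df[OF that]]) (auto intro!: derivative_eq_intros)
    from DERIV_cdivide[OF DERIV_add[OF df[OF that, of r] DERIV_cmult[OF this, of "(-1) ^ i"]], of "4 * pi"]
    show ?thesis by (simp add: F_def)
  qed
  have F_bd: "\<bar>F i r\<bar> \<le> M" if "i \<le> 3" "r \<in> {0..L}" for i r
  proof -
    have "\<bar>f i r + (-1) ^ i * f i (- r)\<bar> \<le> M + M"
      using M[OF that(1), of r] M[OF that(1), of "- r"] that(2)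
      by (intro abs_triangle_ineq[THEN order_trans] add_mono) (auto simp: abs_mult power_abs)
    also have "\<dots> \<le> M * (4 * pi)" using M0 pi_ge_two mult_left_mono[of 2 "4 * pi" M] by simp
    finally show ?thesis by (simp add: F_def divide_le_eq)
  qed
  obtain J where J: "((\<lambda>r. of_real (r * F 0 r / R r) * exp (\<i> * of_real (k * R r))) has_integral J) {0..L}"
    "norm (J - \<i> / of_real k * exp (\<i> * of_real (k * \<bar>h\<bar>)) * of_real (F 0 0)) \<le> M * (2 * R L + L * (1 + R L)) / k\<^sup>2"
  proof -
    have "(F 0 has_real_derivative F 1 r) (at r)" "(F 1 has_real_derivative F 2 r) (at r)"
      "(F 2 has_real_derivative F 3 r) (at r)" for r
      using dF[of 0 r] dF[of 1 r] dF[of 2 r] by (simp_all add: numeral_2_eq_2 numeral_3_eq_3)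
    moreover have "F 1 0 = 0" by (simp add: F_def)
    moreover have "F 0 L = 0" using f_L[of L] f_L[of "- L"] L by (simp add: F_def)
    ultimately show ?thesis
      using radial_stationary_phase[OF L k, of "F 0" "F 1" "F 2" "F 3" M h] F_bd[of 2] F_bd[of 3] that
      unfolding R_def by auto
  qed
  have q_zero: "q r = 0" if "r \<notin> {- L..L}" for r
    using that f_L[of r] by (cases "L \<le> \<bar>r\<bar>") (auto simp: q_def)
  have "(q has_integral integral\<^sup>L lborel q) {- L..L}"
    using has_integral_integral_lborel[OF int_q] q_zero
    by (subst has_integral_restrict_UNIV[symmetric]) (auto elim!: has_integral_eq[rotated])
  then have q_hi: "q integrable_on {- L..L}" "integral\<^sup>L lborel q = integral {- L..L} q"
    by (auto simp: integrable_on_def integral_unique)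
  then have q_half: "q integrable_on {0..L}" "q integrable_on {- L..0}"
    by (auto intro: integrable_on_subinterval)
  have "integral {- L..L} q = integral {- L..0} q + integral {0..L} q"
    using Henstock_Kurzweil_Integration.integral_combine[OF _ _ q_hi(1), of 0] L by simp
  also have "integral {- L..0} q = integral {0..L} (\<lambda>r. q (- r))"
    using Henstock_Kurzweil_Integration.integral_reflect_real[of L 0 "\<lambda>r. q (- r)"] by simp
  also have "\<dots> + integral {0..L} q = integral {0..L} (\<lambda>r. q (- r) + q r)"
    using q_half Henstock_Kurzweil_Integration.integrable_reflect_real[where f=q and a="- L" and b=0]
    by (intro Henstock_Kurzweil_Integration.integral_add[symmetric]) auto
  also have "\<dots> = integral {0..L} (\<lambda>r. of_real (r * F 0 r / R r) * exp (\<i> * of_real (k * R r)))"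
  proof (rule Henstock_Kurzweil_Integration.integral_cong)
    fix r assume "r \<in> {0..L}"
    moreover have "R (- r) = R r" by (simp add: R_def)
    ultimately show "q (- r) + q r = of_real (r * F 0 r / R r) * exp (\<i> * of_real (k * R r))"
      by (simp add: q_def spherical_wave_def F_def scaleR_conv_of_real add_divide_distrib distrib_left distrib_right mult_ac)
  qed
  also have "\<dots> = J" using J(1) by (rule integral_unique)
  finally have "integral\<^sup>L lborel q = J" using q_hi by simp
  moreover have "of_real (F 0 0) = complex_of_real (f 0 0) / of_real (2 * pi)"
    by (simp add: F_def)
  ultimately show "norm (integral\<^sup>L lborel q - \<i> / of_real (2 * pi * k) * exp (\<i> * of_real (k * \<bar>h\<bar>)) * of_real (f 0 0))
      \<le> M * (2 * R L + L * (1 + R L)) / k\<^sup>2"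
    using J(2) by (simp add: mult_ac)
qed

section \<open>Polar coordinates by slope\<close>

text \<open>
Every point off the vertical line through \<open>(x, y)\<close> lies on exactly one line through \<open>(x, y)\<close> of
finite slope \<open>s\<close>, at a signed distance \<open>r\<close>. With \<open>s = tan t\<close> the density is
\<open>\<bar>r\<bar> dr dt\<close>, the usual polar one, for \<open>t\<close> in an interval of length \<open>pi\<close> and \<open>r\<close> of either sign.
\<close>

lemma lborel_eq_distr_slope_polar:
  fixes x y :: real
  defines "T \<equiv> (\<lambda>(s, r). (x + r / sqrt (1 + s\<^sup>2), y + s * r / sqrt (1 + s\<^sup>2)))"
  shows "(lborel :: (real \<times> real) measure) =
    distr (density lborel (\<lambda>p. ennreal (\<bar>snd p\<bar> / (1 + (fst p)\<^sup>2)))) lborel T"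
proof (rule measure_eqI)
  have T[measurable]: "T \<in> borel_measurable borel"
    unfolding T_def split_beta
    by (intro borel_measurable_continuous_onI continuous_intros) (auto simp: add_nonneg_eq_0_iff)
  have [measurable]: "(\<lambda>p. \<bar>snd p\<bar> / (1 + (fst p)\<^sup>2)) \<in> borel_measurable (borel :: (real \<times> real) measure)"
    by (intro borel_measurable_continuous_onI continuous_intros) (auto simp: add_nonneg_eq_0_iff)
  fix A :: "(real \<times> real) set" assume "A \<in> sets lborel"
  then have [measurable]: "A \<in> sets borel" by simp
  define f :: "real \<times> real \<Rightarrow> ennreal" where "f = indicator A"
  have f[measurable]: "f \<in> borel_measurable borel" by (simp add: f_def)
  have "emeasure lborel A = (\<integral>\<^sup>+p. f p \<partial>(lborel \<Otimes>\<^sub>M lborel))"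
    by (simp add: f_def lborel_prod)
  also have "\<dots> = (\<integral>\<^sup>+u. \<integral>\<^sup>+v. f (u, v) \<partial>lborel \<partial>lborel)"
    by (subst lborel.nn_integral_fst[symmetric]) (auto simp: lborel_prod)
  \<comment> \<open>On each vertical line other than the one through the centre, \<open>v = y + (u - x) s\<close>.\<close>
  also have "\<dots> = (\<integral>\<^sup>+u. \<integral>\<^sup>+s. ennreal \<bar>u - x\<bar> * f (u, y + (u - x) * s) \<partial>lborel \<partial>lborel)"
  proof (rule nn_integral_cong_AE)
    have "AE u in lborel. u \<noteq> x" by (rule AE_lborel_singleton)
    then show "AE u in lborel. (\<integral>\<^sup>+v. f (u, v) \<partial>lborel) = (\<integral>\<^sup>+s. ennreal \<bar>u - x\<bar> * f (u, y + (u - x) * s) \<partial>lborel)"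
    proof eventually_elim
      case (elim u)
      then show ?case
        by (subst nn_integral_real_affine[where t=y and c="u - x"]) (auto simp: nn_integral_cmult)
    qed
  qed
  also have "\<dots> = (\<integral>\<^sup>+s. \<integral>\<^sup>+u. ennreal \<bar>u - x\<bar> * f (u, y + (u - x) * s) \<partial>lborel \<partial>lborel)"
  proof (rule lborel_pair.Fubini'[symmetric])
    have [measurable]: "(\<lambda>p. ennreal \<bar>fst p - x\<bar>) \<in> borel_measurable (borel :: (real \<times> real) measure)"
      "(\<lambda>p. (fst p, y + (fst p - x) * snd p)) \<in> borel_measurable (borel :: (real \<times> real) measure)"
      by (intro measurable_compose[OF _ measurable_ennreal] borel_measurable_continuous_onI continuous_intros)+
    show "(\<lambda>(u, s). ennreal \<bar>u - x\<bar> * f (u, y + (u - x) * s)) \<in> borel_measurable (lborel \<Otimes>\<^sub>M lborel)"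
      by (simp add: lborel_prod split_beta)
  qed
  \<comment> \<open>On the line of slope \<open>s\<close>, \<open>u = x + c r\<close> makes \<open>r\<close> the signed distance from the centre.\<close>
  also have "\<dots> = (\<integral>\<^sup>+s. \<integral>\<^sup>+r. ennreal (\<bar>snd (s, r)\<bar> / (1 + (fst (s, r))\<^sup>2)) * f (T (s, r)) \<partial>lborel \<partial>lborel)"
  proof (rule nn_integral_cong)
    fix s :: real
    define c where "c = 1 / sqrt (1 + s\<^sup>2)"
    have pos: "1 + s\<^sup>2 > 0" by (intro add_pos_nonneg) auto
    have c: "c > 0" "c * c = 1 / (1 + s\<^sup>2)" using pos by (auto simp: c_def)
    have "(\<integral>\<^sup>+u. ennreal \<bar>u - x\<bar> * f (u, y + (u - x) * s) \<partial>lborel)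
       = ennreal \<bar>c\<bar> * (\<integral>\<^sup>+r. ennreal \<bar>c * r\<bar> * f (x + c * r, y + (c * r) * s) \<partial>lborel)"
      using c by (subst nn_integral_real_affine[where t=x and c=c]) auto
    also have "\<dots> = (\<integral>\<^sup>+r. ennreal \<bar>c\<bar> * (ennreal \<bar>c * r\<bar> * f (x + c * r, y + (c * r) * s)) \<partial>lborel)"
      by (rule nn_integral_cmult[symmetric]) measurable
    also have "\<dots> = (\<integral>\<^sup>+r. ennreal (\<bar>snd (s, r)\<bar> / (1 + (fst (s, r))\<^sup>2)) * f (T (s, r)) \<partial>lborel)"
    proof (rule nn_integral_cong)
      fix r :: real
      have "ennreal \<bar>c\<bar> * ennreal \<bar>c * r\<bar> = ennreal ((c * c) * \<bar>r\<bar>)"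
        using c(1) by (simp add: abs_mult ennreal_mult[symmetric] mult.assoc)
      moreover have "T (s, r) = (x + c * r, y + (c * r) * s)"
        by (simp add: T_def c_def mult.commute)
      ultimately show "ennreal \<bar>c\<bar> * (ennreal \<bar>c * r\<bar> * f (x + c * r, y + (c * r) * s)) =
        ennreal (\<bar>snd (s, r)\<bar> / (1 + (fst (s, r))\<^sup>2)) * f (T (s, r))"
        by (simp add: mult.assoc[symmetric] c(2))
    qed
    finally show "(\<integral>\<^sup>+u. ennreal \<bar>u - x\<bar> * f (u, y + (u - x) * s) \<partial>lborel) = \<dots>" .
  qed
  also have "\<dots> = (\<integral>\<^sup>+p. ennreal (\<bar>snd p\<bar> / (1 + (fst p)\<^sup>2)) * f (T p) \<partial>(lborel \<Otimes>\<^sub>M lborel))"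
    by (rule lborel.nn_integral_fst) (simp add: lborel_prod)
  also have "\<dots> = (\<integral>\<^sup>+p. f (T p) \<partial>density lborel (\<lambda>p. ennreal (\<bar>snd p\<bar> / (1 + (fst p)\<^sup>2))))"
    unfolding lborel_prod by (rule nn_integral_density[symmetric]) simp_all
  also have "\<dots> = emeasure (distr (density lborel (\<lambda>p. ennreal (\<bar>snd p\<bar> / (1 + (fst p)\<^sup>2)))) lborel T) A"
    by (simp add: f_def nn_integral_distr[symmetric] flip: nn_integral_indicator)
  finally show "emeasure lborel A = \<dots>" .
qed simp

lemma
  fixes x y :: real and g :: "real \<times> real \<Rightarrow> 'b::{banach, second_countable_topology}"
  assumes g[measurable]: "g \<in> borel_measurable borel"
  defines "G \<equiv> (\<lambda>(s, r). (\<bar>r\<bar> / (1 + s\<^sup>2)) *\<^sub>R g (x + r / sqrt (1 + s\<^sup>2), y + s * r / sqrt (1 + s\<^sup>2)))"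
  shows integrable_slope_polar: "integrable lborel g \<longleftrightarrow> integrable lborel G"
    and integral_slope_polar: "integral\<^sup>L lborel g = integral\<^sup>L lborel G"
proof -
  have [measurable]: "(\<lambda>p. (x + snd p / sqrt (1 + (fst p)\<^sup>2), y + fst p * snd p / sqrt (1 + (fst p)\<^sup>2)))
      \<in> borel_measurable (borel :: (real \<times> real) measure)"
    "(\<lambda>p. \<bar>snd p\<bar> / (1 + (fst p)\<^sup>2)) \<in> borel_measurable (borel :: (real \<times> real) measure)"
    by (intro borel_measurable_continuous_onI continuous_intros; auto simp: add_nonneg_eq_0_iff)+
  show "integrable lborel g \<longleftrightarrow> integrable lborel G"
    unfolding G_def split_beta
    by (subst lborel_eq_distr_slope_polar[of x y], subst integrable_distr_eq)
       (simp_all add: integrable_density split_beta)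
  show "integral\<^sup>L lborel g = integral\<^sup>L lborel G"
    unfolding G_def split_beta
    by (subst lborel_eq_distr_slope_polar[of x y], subst integral_distr)
       (simp_all add: integral_density split_beta)
qed

text \<open>
The angular measure and its total mass, in the form in which the slope coordinates use them.
\<close>

lemma
  shows integrable_arctan_deriv: "integrable lborel (\<lambda>s::real. 1 / (1 + s\<^sup>2))"
    and integral_arctan_deriv: "(LINT s|lborel. 1 / (1 + s\<^sup>2)) = pi"
proof -
  have [simp]: "einterval (-\<infinity>) \<infinity> = UNIV" by (auto simp: einterval_def)
  show "integrable lborel (\<lambda>s::real. 1 / (1 + s\<^sup>2))"
    using integrable_inverse_1_plus_square by (simp add: set_integrable_def inverse_eq_divide)
  show "(LINT s|lborel. 1 / (1 + s\<^sup>2)) = pi"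
    using LBINT_inverse_1_plus_square
    by (simp add: interval_lebesgue_integral_def set_lebesgue_integral_def inverse_eq_divide)
qed

section \<open>Derivatives along lines, uniformly in the direction\<close>

text \<open>
The derivative of \<open>\<psi>\<close> along a line of direction \<open>a u + b v\<close> is \<open>a\<close> times the restriction of its
\<open>u\<close>-derivative plus \<open>b\<close> times that of its \<open>v\<close>-derivative. By induction all higher derivatives are
combinations, with coefficients bounded by one, of restrictions of finitely many fixed
continuous functions. Each of these is bounded on a ball that contains all the segments
considered, so \<open>M\<close> does not depend on \<open>a\<close> and \<open>b\<close>.
\<close>

lemma Ck_function_along_lines:
  fixes \<psi> :: "'a::euclidean_space \<Rightarrow> real" and p u v :: 'a and L :: real
  assumes "Ck_function n \<psi>"
  shows "\<exists>M. \<forall>a b. \<bar>a\<bar> \<le> 1 \<longrightarrow> \<bar>b\<bar> \<le> 1 \<longrightarrow>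
    (\<exists>f :: nat \<Rightarrow> real \<Rightarrow> real. f 0 = (\<lambda>r. \<psi> (p + r *\<^sub>R (a *\<^sub>R u + b *\<^sub>R v))) \<and>
      (\<forall>i<n. \<forall>r. (f i has_real_derivative f (Suc i) r) (at r)) \<and>
      (\<forall>i\<le>n. \<forall>r. \<bar>r\<bar> \<le> L \<longrightarrow> \<bar>f i r\<bar> \<le> M))"
  using assms
proof (induction n arbitrary: \<psi>)
  have bounded_along_lines: "\<exists>M. \<forall>a b r. \<bar>a\<bar> \<le> 1 \<longrightarrow> \<bar>b\<bar> \<le> 1 \<longrightarrow> \<bar>r\<bar> \<le> L \<longrightarrow>
      \<bar>\<psi> (p + r *\<^sub>R (a *\<^sub>R u + b *\<^sub>R v))\<bar> \<le> M"
    if "continuous_on UNIV \<psi>" for \<psi> :: "'a \<Rightarrow> real"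
  proof -
    define K where "K = cball p (L * (norm u + norm v))"
    have "compact (\<psi> ` K)"
      by (intro compact_continuous_image continuous_on_subset[OF that]) (auto simp: K_def)
    then obtain M where M: "\<And>q. q \<in> K \<Longrightarrow> \<bar>\<psi> q\<bar> \<le> M"
      by (meson bounded_real compact_imp_bounded imageI)
    have "p + r *\<^sub>R (a *\<^sub>R u + b *\<^sub>R v) \<in> K" if "\<bar>a\<bar> \<le> 1" "\<bar>b\<bar> \<le> 1" "\<bar>r\<bar> \<le> L" for a b r
    proof -
      have "norm (a *\<^sub>R u + b *\<^sub>R v) \<le> 1 * norm u + 1 * norm v"
        using that by (intro norm_triangle_le add_mono) (auto intro: mult_left_le_one_le)
      then have "\<bar>r\<bar> * norm (a *\<^sub>R u + b *\<^sub>R v) \<le> L * (norm u + norm v)"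
        using that by (intro mult_mono) auto
      then show ?thesis by (simp add: K_def dist_norm)
    qed
    with M show ?thesis by blast
  qed
  {
    case 0
    then obtain M where M: "\<forall>a b r. \<bar>a\<bar> \<le> 1 \<longrightarrow> \<bar>b\<bar> \<le> 1 \<longrightarrow> \<bar>r\<bar> \<le> L \<longrightarrow> \<bar>\<psi> (p + r *\<^sub>R (a *\<^sub>R u + b *\<^sub>R v))\<bar> \<le> M"
      using bounded_along_lines[of \<psi>] by auto
    show ?case
      by (rule exI[of _ M], intro allI impI, rule exI[of _ "\<lambda>i r. \<psi> (p + r *\<^sub>R (_ *\<^sub>R u + _ *\<^sub>R v))"])
         (use M in auto)
  next
    case (Suc n)
    define D where "D = (\<lambda>w x. frechet_derivative \<psi> (at x) w)"
    have diff: "\<psi> differentiable (at x)" for x using Suc.prems by simp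
    have "continuous_on UNIV \<psi>"
      using diff by (auto intro!: continuous_at_imp_continuous_on differentiable_imp_continuous_within)
    then obtain M0 where M0: "\<forall>a b r. \<bar>a\<bar> \<le> 1 \<longrightarrow> \<bar>b\<bar> \<le> 1 \<longrightarrow> \<bar>r\<bar> \<le> L \<longrightarrow> \<bar>\<psi> (p + r *\<^sub>R (a *\<^sub>R u + b *\<^sub>R v))\<bar> \<le> M0"
      using bounded_along_lines[of \<psi>] by auto
    have CkD: "Ck_function n (D w)" for w using Suc.prems by (simp add: D_def)
    obtain M1 where M1: "\<And>a b. \<bar>a\<bar> \<le> 1 \<Longrightarrow> \<bar>b\<bar> \<le> 1 \<Longrightarrow>
      (\<exists>f :: nat \<Rightarrow> real \<Rightarrow> real. f 0 = (\<lambda>r. D u (p + r *\<^sub>R (a *\<^sub>R u + b *\<^sub>R v))) \<and>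
      (\<forall>i<n. \<forall>r. (f i has_real_derivative f (Suc i) r) (at r)) \<and>
      (\<forall>i\<le>n. \<forall>r. \<bar>r\<bar> \<le> L \<longrightarrow> \<bar>f i r\<bar> \<le> M1))"
      using Suc.IH[OF CkD[of u]] by blast
    obtain M2 where M2: "\<And>a b. \<bar>a\<bar> \<le> 1 \<Longrightarrow> \<bar>b\<bar> \<le> 1 \<Longrightarrow>
      (\<exists>f :: nat \<Rightarrow> real \<Rightarrow> real. f 0 = (\<lambda>r. D v (p + r *\<^sub>R (a *\<^sub>R u + b *\<^sub>R v))) \<and>
      (\<forall>i<n. \<forall>r. (f i has_real_derivative f (Suc i) r) (at r)) \<and>
      (\<forall>i\<le>n. \<forall>r. \<bar>r\<bar> \<le> L \<longrightarrow> \<bar>f i r\<bar> \<le> M2))"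
      using Suc.IH[OF CkD[of v]] by blast
    show ?case
    proof (rule exI[of _ "max M0 (M1 + M2)"], intro allI impI)
      fix a b :: real assume ab: "\<bar>a\<bar> \<le> 1" "\<bar>b\<bar> \<le> 1"
      obtain g where g: "g 0 = (\<lambda>r. D u (p + r *\<^sub>R (a *\<^sub>R u + b *\<^sub>R v)))"
        "\<And>i r. i < n \<Longrightarrow> (g i has_real_derivative g (Suc i) r) (at r)"
        "\<And>i r. i \<le> n \<Longrightarrow> \<bar>r\<bar> \<le> L \<Longrightarrow> \<bar>g i r\<bar> \<le> M1"
        using M1[OF ab] by blast
      obtain h where h: "h 0 = (\<lambda>r. D v (p + r *\<^sub>R (a *\<^sub>R u + b *\<^sub>R v)))"
        "\<And>i r. i < n \<Longrightarrow> (h i has_real_derivative h (Suc i) r) (at r)"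
        "\<And>i r. i \<le> n \<Longrightarrow> \<bar>r\<bar> \<le> L \<Longrightarrow> \<bar>h i r\<bar> \<le> M2"
        using M2[OF ab] by blast
      define f where "f = (\<lambda>i r. case i of 0 \<Rightarrow> \<psi> (p + r *\<^sub>R (a *\<^sub>R u + b *\<^sub>R v)) | Suc j \<Rightarrow> a * g j r + b * h j r)"
      have "(f i has_real_derivative f (Suc i) r) (at r)" if "i < Suc n" for i r
      proof (cases i)
        case 0
        let ?w = "a *\<^sub>R u + b *\<^sub>R v"
        let ?d = "frechet_derivative \<psi> (at (p + r *\<^sub>R ?w))"
        have d: "(\<psi> has_derivative ?d) (at (p + r *\<^sub>R ?w))"
          using diff frechet_derivative_works by blast
        have lin: "linear ?d" using d by (rule has_derivative_linear)
        have "((\<lambda>r. \<psi> (p + r *\<^sub>R ?w)) has_derivative (\<lambda>t. ?d (t *\<^sub>R ?w))) (at r)"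
          by (rule has_derivative_compose[where f="\<lambda>r. p + r *\<^sub>R ?w" and g=\<psi>, OF _ d]) (auto intro!: derivative_eq_intros)
        moreover have "?d (t *\<^sub>R ?w) = (a * g 0 r + b * h 0 r) * t" for t
          using lin by (simp add: linear_add linear_scale g(1) h(1) D_def algebra_simps)
        ultimately show ?thesis
          by (simp add: 0 f_def has_field_derivative_def fun_eq_iff)
      next
        case (Suc j)
        with that show ?thesis
          by (auto simp: f_def intro!: derivative_eq_intros g(2) h(2))
      qed
      moreover have "\<bar>f i r\<bar> \<le> max M0 (M1 + M2)" if "i \<le> Suc n" "\<bar>r\<bar> \<le> L" for i r
      proof (cases i)
        case 0
        with M0 ab that show ?thesis by (auto simp: f_def le_max_iff_disj)
      next
        case (Suc j)
        have scale: "\<bar>c * t\<bar> \<le> B" if "\<bar>c\<bar> \<le> 1" "\<bar>t\<bar> \<le> B" for c t B :: real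
          using mult_mono[of "\<bar>c\<bar>" 1 "\<bar>t\<bar>" B] that by (simp add: abs_mult)
        have "\<bar>a * g j r + b * h j r\<bar> \<le> M1 + M2"
          using ab that Suc g(3)[of j r] h(3)[of j r]
          by (intro abs_triangle_ineq[THEN order_trans] add_mono scale) auto
        then show ?thesis by (simp add: f_def Suc)
      qed
      moreover have "f 0 = (\<lambda>r. \<psi> (p + r *\<^sub>R (a *\<^sub>R u + b *\<^sub>R v)))" by (simp add: f_def)
      ultimately show "\<exists>f :: nat \<Rightarrow> real \<Rightarrow> real. f 0 = (\<lambda>r. \<psi> (p + r *\<^sub>R (a *\<^sub>R u + b *\<^sub>R v))) \<and>
          (\<forall>i<Suc n. \<forall>r. (f i has_real_derivative f (Suc i) r) (at r)) \<and>
          (\<forall>i\<le>Suc n. \<forall>r. \<bar>r\<bar> \<le> L \<longrightarrow> \<bar>f i r\<bar> \<le> max M0 (M1 + M2))"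
        by blast
    qed
  }
qed

section \<open>The spherical wave integrated over a plane\<close>

text \<open>
The plane is the one spanned by \<open>u\<close> and \<open>v\<close> through \<open>p\<close>, the foot of the perpendicular from the
observation point. On every line through \<open>p\<close> the one-dimensional expansion holds with the same
leading term and the same error bound; these are then integrated over the slope.
\<close>

lemma plane_stationary_phase:
  fixes \<psi> :: "'a::euclidean_space \<Rightarrow> real" and p u v :: 'a and x y h L :: real
  defines "g \<equiv> (\<lambda>k (\<xi>1, \<xi>2). spherical_wave k (sqrt ((x - \<xi>1)\<^sup>2 + (y - \<xi>2)\<^sup>2 + h\<^sup>2)) 
      * of_real (\<psi> (p + (\<xi>1 - x) *\<^sub>R u + (\<xi>2 - y) *\<^sub>R v)))"
  assumes Ck: "Ck_function 3 \<psi>" and L: "L > 0"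
    and supp: "\<And>a b. L\<^sup>2 \<le> a\<^sup>2 + b\<^sup>2 \<Longrightarrow> \<psi> (p + a *\<^sub>R u + b *\<^sub>R v) = 0"
  shows "\<And>k. k > 0 \<Longrightarrow> integrable lborel (g k)"
    and "\<exists>C. \<forall>k>0. norm (integral\<^sup>L lborel (g k) - \<i> / of_real (2 * k) * exp (\<i> * of_real (k * \<bar>h\<bar>)) * of_real (\<psi> p))
      \<le> C / k\<^sup>2"
proof -
  define R where "R = (\<lambda>r. sqrt (r\<^sup>2 + h\<^sup>2))"
  \<comment> \<open>\<open>(c s, c s * s)\<close> is the unit vector of slope \<open>s\<close>, and \<open>q k s\<close> is the integrand along it.\<close>
  define c where "c = (\<lambda>s::real. 1 / sqrt (1 + s\<^sup>2))"
  define q where "q = (\<lambda>k s r. \<bar>r\<bar> *\<^sub>R (spherical_wave k (R r) * of_real (\<psi> (p + r *\<^sub>R (c s *\<^sub>R u + (c s * s) *\<^sub>R v)))))"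
  have pos: "1 + s\<^sup>2 > 0" for s :: real by (intro add_pos_nonneg) auto
  have c_bd: "\<bar>c s\<bar> \<le> 1" "\<bar>c s * s\<bar> \<le> 1" for s
    using pos[of s] by (auto simp: c_def divide_le_eq_1 intro!: real_le_rsqrt)
  have c_unit: "(c s)\<^sup>2 + (c s * s)\<^sup>2 = 1" for s
    using pos[of s] by (simp add: c_def power_mult_distrib power_divide add_divide_distrib[symmetric])
  obtain M where M: "\<And>a b. \<bar>a\<bar> \<le> 1 \<Longrightarrow> \<bar>b\<bar> \<le> 1 \<Longrightarrow>
    (\<exists>f :: nat \<Rightarrow> real \<Rightarrow> real. f 0 = (\<lambda>r. \<psi> (p + r *\<^sub>R (a *\<^sub>R u + b *\<^sub>R v))) \<and>
      (\<forall>i<3. \<forall>r. (f i has_real_derivative f (Suc i) r) (at r)) \<and>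
      (\<forall>i\<le>3. \<forall>r. \<bar>r\<bar> \<le> L \<longrightarrow> \<bar>f i r\<bar> \<le> M))"
    using Ck_function_along_lines[OF Ck, of p u v L] by blast
  define C where "C = M * (2 * R L + L * (1 + R L))"
  define A where "A = (\<lambda>k. \<i> / of_real (2 * pi * k) * exp (\<i> * of_real (k * \<bar>h\<bar>)) * of_real (\<psi> p))"
  have q: "norm (q k s r) \<le> M * indicator {-L..L} r" "integrable lborel (q k s)"
      "norm (integral\<^sup>L lborel (q k s) - A k) \<le> C / k\<^sup>2" if k: "k > 0" for k s r
  proof -
    obtain f where f: "f 0 = (\<lambda>r. \<psi> (p + r *\<^sub>R (c s *\<^sub>R u + (c s * s) *\<^sub>R v)))"
      "\<And>i r. i < 3 \<Longrightarrow> (f i has_real_derivative f (Suc i) r) (at r)"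
      "\<And>i r. i \<le> 3 \<Longrightarrow> \<bar>r\<bar> \<le> L \<Longrightarrow> \<bar>f i r\<bar> \<le> M"
      using M[OF c_bd[of s]] by blast
    have f_L: "f 0 r = 0" if "L \<le> \<bar>r\<bar>" for r
    proof -
      have "L\<^sup>2 \<le> r\<^sup>2" using power_mono[OF that, of 2] L by simp
      also have "\<dots> = (r * c s)\<^sup>2 + (r * (c s * s))\<^sup>2"
        using c_unit[of s] by (simp add: power_mult_distrib[of r] distrib_left[symmetric])
      finally show ?thesis
        using supp[of "r * c s" "r * (c s * s)"] by (simp add: f(1) scaleR_add_right add.assoc)
    qed
    have eq: "q k s = (\<lambda>r. \<bar>r\<bar> *\<^sub>R (spherical_wave k (sqrt (r\<^sup>2 + h\<^sup>2)) * of_real (f 0 r)))"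
      by (simp add: q_def R_def f(1))
    show "norm (q k s r) \<le> M * indicator {-L..L} r"
      using full_line_stationary_phase(1)[OF L k f(2,3) f_L, of r h] by (simp add: eq)
    show "integrable lborel (q k s)"
      using full_line_stationary_phase(2)[OF L k f(2,3) f_L, of h] by (simp add: eq)
    show "norm (integral\<^sup>L lborel (q k s) - A k) \<le> C / k\<^sup>2"
      using full_line_stationary_phase(3)[OF L k f(2,3) f_L, of h]
      by (simp add: eq A_def C_def R_def f(1))
  qed
  have M0: "M \<ge> 0" using order_trans[OF norm_ge_zero q(1)[of 1 0 0]] L by simp
  have "\<psi> differentiable (at z)" for z using Ck by (simp add: numeral_3_eq_3)
  then have \<psi>_cont: "continuous_on UNIV \<psi>"
    by (auto intro!: continuous_at_imp_continuous_on differentiable_imp_continuous_within)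
  have [measurable]: "(\<lambda>z. \<psi> (p + (fst z - x) *\<^sub>R u + (snd z - y) *\<^sub>R v)) \<in> borel_measurable (borel :: (real \<times> real) measure)"
    "(\<lambda>z. sqrt ((x - fst z)\<^sup>2 + (y - snd z)\<^sup>2 + h\<^sup>2)) \<in> borel_measurable (borel :: (real \<times> real) measure)"
    by (intro borel_measurable_continuous_onI continuous_on_compose2[OF \<psi>_cont] continuous_intros; simp)+
  have g_meas: "g k \<in> borel_measurable borel" for k
    unfolding g_def split_beta spherical_wave_def by simp
  have G: "(\<lambda>(s, r). (\<bar>r\<bar> / (1 + s\<^sup>2)) *\<^sub>R g k (x + r / sqrt (1 + s\<^sup>2), y + s * r / sqrt (1 + s\<^sup>2)))
      = (\<lambda>(s, r). (1 / (1 + s\<^sup>2)) *\<^sub>R q k s r)" for k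
  proof (intro ext, clarify)
    fix s r
    have "(x - (x + r / sqrt (1 + s\<^sup>2)))\<^sup>2 + (y - (y + s * r / sqrt (1 + s\<^sup>2)))\<^sup>2 = r\<^sup>2 * ((c s)\<^sup>2 + (c s * s)\<^sup>2)"
      by (simp add: c_def power_divide power_mult_distrib algebra_simps)
    then have R: "sqrt ((x - (x + r / sqrt (1 + s\<^sup>2)))\<^sup>2 + (y - (y + s * r / sqrt (1 + s\<^sup>2)))\<^sup>2 + h\<^sup>2) = R r"
      by (simp add: c_unit R_def)
    have P: "p + (x + r / sqrt (1 + s\<^sup>2) - x) *\<^sub>R u + (y + s * r / sqrt (1 + s\<^sup>2) - y) *\<^sub>R v
      = p + r *\<^sub>R (c s *\<^sub>R u + (c s * s) *\<^sub>R v)"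
      by (simp add: c_def scaleR_add_right add.assoc mult.commute)
    show "(\<bar>r\<bar> / (1 + s\<^sup>2)) *\<^sub>R g k (x + r / sqrt (1 + s\<^sup>2), y + s * r / sqrt (1 + s\<^sup>2)) = (1 / (1 + s\<^sup>2)) *\<^sub>R q k s r"
      unfolding g_def q_def prod.case R P by simp
  qed
  have G_meas: "(\<lambda>(s, r). (1 / (1 + s\<^sup>2)) *\<^sub>R q k s r) \<in> borel_measurable (lborel \<Otimes>\<^sub>M lborel)" for k
  proof -
    have "(\<lambda>z. \<psi> (p + snd z *\<^sub>R (c (fst z) *\<^sub>R u + (c (fst z) * fst z) *\<^sub>R v))) \<in> borel_measurable (borel :: (real \<times> real) measure)"
      unfolding c_def
      by (intro borel_measurable_continuous_onI continuous_on_compose2[OF \<psi>_cont] continuous_intros)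
         (auto simp: add_nonneg_eq_0_iff)
    moreover have "(\<lambda>z. R (snd z)) \<in> borel_measurable (borel :: (real \<times> real) measure)"
      "(\<lambda>z. \<bar>snd z\<bar>) \<in> borel_measurable (borel :: (real \<times> real) measure)"
      "(\<lambda>z. 1 / (1 + (fst z)\<^sup>2)) \<in> borel_measurable (borel :: (real \<times> real) measure)"
      unfolding R_def
      by (intro borel_measurable_continuous_onI continuous_intros; auto simp: add_nonneg_eq_0_iff)+
    ultimately show ?thesis
      unfolding q_def split_beta spherical_wave_def lborel_prod measurable_lborel1 by measurable
  qed
  \<comment> \<open>Each \<open>q k s\<close> is bounded by \<open>M\<close> on \<open>{-L..L}\<close>: the Jacobian has removed the singularity at
    the centre, and \<open>1 / (1 + s\<^sup>2)\<close> is integrable in \<open>s\<close>.\<close>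
  have G_int: "integrable (lborel \<Otimes>\<^sub>M lborel) (\<lambda>(s, r). (1 / (1 + s\<^sup>2)) *\<^sub>R q k s r)" if k: "k > 0" for k
  proof (rule lborel_pair.Fubini_integrable[OF G_meas])
    show "AE s in lborel. integrable lborel (\<lambda>r. case (s, r) of (s, r) \<Rightarrow> (1 / (1 + s\<^sup>2)) *\<^sub>R q k s r)"
      using q(2)[OF k] by simp
    have *: "(\<lambda>s. LINT r|lborel. norm (case (s, r) of (s, r) \<Rightarrow> (1 / (1 + s\<^sup>2)) *\<^sub>R q k s r)) \<in> borel_measurable lborel"
      using measurable_compose[OF G_meas[of k] borel_measurable_norm] by (intro lborel.borel_measurable_lebesgue_integral) (simp add: split_beta')
    show "integrable lborel (\<lambda>s. LINT r|lborel. norm (case (s, r) of (s, r) \<Rightarrow> (1 / (1 + s\<^sup>2)) *\<^sub>R q k s r))"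
    proof (rule Bochner_Integration.integrable_bound[OF _ *])
      show "integrable lborel (\<lambda>s::real. 1 / (1 + s\<^sup>2) * (M * (2 * L)))"
        by (intro integrable_mult_left integrable_arctan_deriv)
      have "(LINT r|lborel. norm (q k s r)) \<le> M * (2 * L)" for s
      proof -
        have "(LINT r|lborel. norm (q k s r)) \<le> (LINT r|lborel. M * indicator {-L..L} r)"
          using q(1)[OF k] q(2)[OF k]
          by (intro integral_mono integrable_norm integrable_mult_right integrable_real_indicator)
             (auto simp: emeasure_lborel_Icc_eq)
        also have "\<dots> = M * (2 * L)" using L by simp
        finally show ?thesis .
      qed
      then show "AE s in lborel. norm (LINT r|lborel. norm (case (s, r) of (s, r) \<Rightarrow> (1 / (1 + s\<^sup>2)) *\<^sub>R q k s r))
          \<le> norm (1 / (1 + s\<^sup>2) * (M * (2 * L)))"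
        using pos M0 L by (intro AE_I2) (auto simp: abs_mult less_imp_le intro!: divide_right_mono)
    qed
  qed
  show "integrable lborel (g k)" if "k > 0" for k
    using G_int[OF that] by (simp only: integrable_slope_polar[OF g_meas, of _ x y] G lborel_prod)
  have "norm (integral\<^sup>L lborel (g k) - \<i> / of_real (2 * k) * exp (\<i> * of_real (k * \<bar>h\<bar>)) * of_real (\<psi> p)) \<le> (C * pi) / k\<^sup>2"
    if k: "k > 0" for k
  proof -
    have int_q: "integrable lborel (\<lambda>s. (1 / (1 + s\<^sup>2)) *\<^sub>R integral\<^sup>L lborel (q k s))"
      using lborel_pair.integrable_fst'[OF G_int[OF k]] by simp
    have int_A: "integrable lborel (\<lambda>s. (1 / (1 + s\<^sup>2)) *\<^sub>R A k)"
      by (intro integrable_scaleR_left integrable_arctan_deriv)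
    have "integral\<^sup>L lborel (g k) = (LINT z|(lborel \<Otimes>\<^sub>M lborel). (\<lambda>(s, r). (1 / (1 + s\<^sup>2)) *\<^sub>R q k s r) z)"
      by (simp only: integral_slope_polar[OF g_meas, of _ x y] G lborel_prod)
    also have "\<dots> = (LINT s|lborel. (1 / (1 + s\<^sup>2)) *\<^sub>R integral\<^sup>L lborel (q k s))"
      using lborel_pair.integral_fst'[OF G_int[OF k]] by simp
    finally have g: "integral\<^sup>L lborel (g k) = \<dots>" .
    \<comment> \<open>The leading term does not depend on the direction, so averaging it produces the factor \<open>pi\<close>.\<close>
    have A: "\<i> / of_real (2 * k) * exp (\<i> * of_real (k * \<bar>h\<bar>)) * of_real (\<psi> p) = (LINT s|lborel. (1 / (1 + s\<^sup>2)) *\<^sub>R A k)"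
    proof -
      have "(LINT s|lborel. (1 / (1 + s\<^sup>2)) *\<^sub>R A k) = pi *\<^sub>R A k"
        using integrable_arctan_deriv by (subst integral_scaleR_left) (auto simp: integral_arctan_deriv)
      also have "\<dots> = \<i> / of_real (2 * k) * exp (\<i> * of_real (k * \<bar>h\<bar>)) * of_real (\<psi> p)"
        by (simp add: A_def scaleR_conv_of_real)
      finally show ?thesis by simp
    qed
    have "norm (integral\<^sup>L lborel (g k) - \<i> / of_real (2 * k) * exp (\<i> * of_real (k * \<bar>h\<bar>)) * of_real (\<psi> p))
      = norm (LINT s|lborel. (1 / (1 + s\<^sup>2)) *\<^sub>R (integral\<^sup>L lborel (q k s) - A k))"
      unfolding g A using int_q int_A by (simp add: scaleR_diff_right)
    also have "\<dots> \<le> (LINT s|lborel. 1 / (1 + s\<^sup>2) * (C / k\<^sup>2))"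
    proof (rule order_trans[OF integral_norm_bound integral_mono])
      show "integrable lborel (\<lambda>s. norm ((1 / (1 + s\<^sup>2)) *\<^sub>R (integral\<^sup>L lborel (q k s) - A k)))"
        using Bochner_Integration.integrable_diff[OF int_q int_A]
        by (intro integrable_norm) (simp add: scaleR_diff_right)
      show "integrable lborel (\<lambda>s::real. 1 / (1 + s\<^sup>2) * (C / k\<^sup>2))"
        by (intro integrable_mult_left integrable_arctan_deriv)
      fix s :: real
      show "norm ((1 / (1 + s\<^sup>2)) *\<^sub>R (integral\<^sup>L lborel (q k s) - A k)) \<le> 1 / (1 + s\<^sup>2) * (C / k\<^sup>2)"
        unfolding norm_scaleR using pos[of s] q(3)[OF k, of s] by (intro mult_mono) auto
    qed
    also have "\<dots> = (C * pi) / k\<^sup>2"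
      by (simp only: integral_mult_left_zero integral_arctan_deriv) simp
    finally show ?thesis .
  qed
  then show "\<exists>C. \<forall>k>0. norm (integral\<^sup>L lborel (g k) - \<i> / of_real (2 * k) * exp (\<i> * of_real (k * \<bar>h\<bar>)) * of_real (\<psi> p)) \<le> C / k\<^sup>2"
    by blast
qed

theorem lemma3p2:
  fixes D \<eta> \<theta> x0 y0 z0 x y z :: real
    and m :: "real \<Rightarrow> real \<Rightarrow> real^3 \<Rightarrow> real^3 \<Rightarrow> real \<Rightarrow> real"
  defines "p0 \<equiv> (vector [x0, y0, z0] :: real^3)"
  defines "disk \<equiv> {(\<xi>1, \<xi>2). (vector [\<xi>1, \<xi>2, z0] :: real^3) \<in> antenna_disk p0 \<theta> D}"
  defines "integrand \<equiv> (\<lambda>(k::real) (\<xi>1, \<xi>2).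
      spherical_wave k (sqrt ((x - \<xi>1)\<^sup>2 + (y - \<xi>2)\<^sup>2 + (z - z0)\<^sup>2))
        * complex_of_real (m \<eta> \<theta> (vector [\<xi>1, \<xi>2, z0]) p0 D))"
  defines "I \<equiv> (\<lambda>k::real. (LINT \<xi>:disk|lborel. integrand k \<xi>))"
  assumes "D > 0" and "\<eta> \<in> {0<..<D/2}" and "\<theta> \<in> {0<..<pi/2}"
    and "antenna_cutoff \<eta> p0 D (\<lambda>p. m \<eta> \<theta> p p0 D)"
  shows "(\<forall>k>0. set_integrable lborel disk (integrand k)) \<and>
     ((x, y) \<in> disk \<longrightarrow>
        (\<exists>R :: real \<Rightarrow> complex. R \<in> O[at_top](\<lambda>k. of_real (1 / k)) \<and>
           (\<forall>k>0. I k = \<i> / of_real (2 * k) * exp (\<i> * of_real (k * \<bar>z - z0\<bar>))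
                        * (of_real (m \<eta> \<theta> (vector [x, y, z0]) p0 D) + R k)))) \<and>
     ((x, y) \<notin> disk \<longrightarrow> I \<in> O[at_top](\<lambda>k. of_real (1 / k\<^sup>2)))"
proof -
  define \<psi> where "\<psi> = (\<lambda>p. m \<eta> \<theta> p p0 D)"
  define u v :: "real^3" where "u = axis 1 1" and "v = axis 2 1"
  define P :: "real^3" where "P = vector [x, y, z0]"
  have vec: "vector [\<xi>1, \<xi>2, z0] = P + (\<xi>1 - x) *\<^sub>R u + (\<xi>2 - y) *\<^sub>R v" for \<xi>1 \<xi>2
    by (simp add: vec_eq_iff forall_3 P_def u_def v_def axis_def)
  have cutoff: "smooth_function \<psi>" "\<And>p. norm (p - p0) \<ge> D / 2 \<Longrightarrow> \<psi> p = 0"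
    using assms(8) by (auto simp: antenna_cutoff_def \<psi>_def)
  have disk: "(\<xi>1, \<xi>2) \<in> disk \<longleftrightarrow> (\<xi>1 - x0)\<^sup>2 + (\<xi>2 - y0)\<^sup>2 < D\<^sup>2 / 4" for \<xi>1 \<xi>2
    by (simp add: disk_def antenna_disk_def p0_def)
  have norm: "norm (vector [\<xi>1, \<xi>2, z0] - p0) = sqrt ((\<xi>1 - x0)\<^sup>2 + (\<xi>2 - y0)\<^sup>2)" for \<xi>1 \<xi>2
    by (simp add: norm_vec_def L2_set_def sum_3 p0_def)
  have outside: "\<psi> (vector [\<xi>1, \<xi>2, z0]) = 0" if "(\<xi>1, \<xi>2) \<notin> disk" for \<xi>1 \<xi>2
  proof (rule cutoff(2), unfold norm, rule real_le_rsqrt)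
    show "(D / 2)\<^sup>2 \<le> (\<xi>1 - x0)\<^sup>2 + (\<xi>2 - y0)\<^sup>2"
      using that by (simp add: disk power_divide)
  qed
  \<comment> \<open>The disk of radius \<open>L\<close> around \<open>(x, y)\<close> contains the antenna disk by the triangle inequality.\<close>
  define d where "d = sqrt ((x - x0)\<^sup>2 + (y - y0)\<^sup>2)"
  define L where "L = D / 2 + d"
  have L: "L > 0" using \<open>D > 0\<close> by (auto simp: L_def d_def intro!: add_pos_nonneg)
  have supp: "\<psi> (P + a *\<^sub>R u + b *\<^sub>R v) = 0"
    if "L\<^sup>2 \<le> a\<^sup>2 + b\<^sup>2" for a b
  proof -
    have "L \<le> sqrt (a\<^sup>2 + b\<^sup>2)" using that by (rule real_le_rsqrt)
    also have "\<dots> \<le> sqrt ((x + a - x0)\<^sup>2 + (y + b - y0)\<^sup>2) + sqrt ((x0 - x)\<^sup>2 + (y0 - y)\<^sup>2)"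
      using real_sqrt_sum_squares_triangle_ineq[of "x + a - x0" "x0 - x" "y + b - y0" "y0 - y"] by simp
    finally have "D / 2 \<le> norm (vector [x + a, y + b, z0] - p0)"
      unfolding norm by (simp add: L_def d_def power2_commute)
    then show ?thesis using cutoff(2) by (simp add: vec)
  qed
  have integrand: "integrand k = (\<lambda>(\<xi>1, \<xi>2). spherical_wave k (sqrt ((x - \<xi>1)\<^sup>2 + (y - \<xi>2)\<^sup>2 + (z - z0)\<^sup>2))
      * of_real (\<psi> (P + (\<xi>1 - x) *\<^sub>R u + (\<xi>2 - y) *\<^sub>R v)))" for k
    by (simp add: integrand_def \<psi>_def vec fun_eq_iff)
  \<comment> \<open>The cut-off vanishes off the disk, so the integral may be taken over the whole plane.\<close>
  have ind: "(\<lambda>\<xi>. indicator disk \<xi> *\<^sub>R integrand k \<xi>) = integrand k" for k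
    using outside by (auto simp: fun_eq_iff integrand_def \<psi>_def indicator_def)
  have Ck: "Ck_function 3 \<psi>" using cutoff(1) by (simp add: smooth_function_def)
  \<comment> \<open>Inside and outside the disk the same expansion \<open>I k = E k * \<mu> + O(1 / k\<^sup>2)\<close> holds; outside,
    \<open>\<mu> = 0\<close>, and inside it is divided by \<open>E k\<close>, which has modulus \<open>1 / (2 k)\<close>.\<close>
  define E where "E = (\<lambda>k. \<i> / of_real (2 * k) * exp (\<i> * of_real (k * \<bar>z - z0\<bar>)))"
  define \<mu> where "\<mu> = \<psi> (vector [x, y, z0])"
  have integrable: "set_integrable lborel disk (integrand k)" if "k > 0" for k
    unfolding set_integrable_def ind unfolding integrand
    using Ck L supp that by (rule plane_stationary_phase(1))
  have "\<exists>C. \<forall>k>0. norm (integral\<^sup>L lborel (integrand k)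
      - \<i> / of_real (2 * k) * exp (\<i> * of_real (k * \<bar>z - z0\<bar>)) * of_real (\<psi> P)) \<le> C / k\<^sup>2"
    unfolding integrand using Ck L supp by (rule plane_stationary_phase(2))
  then obtain C where C: "\<And>k. k > 0 \<Longrightarrow> norm (I k - E k * of_real \<mu>) \<le> C / k\<^sup>2"
    unfolding I_def set_lebesgue_integral_def ind E_def \<mu>_def P_def by blast
  have normE: "norm (E k) = 1 / (2 * k)" if "k > 0" for k
    using that by (simp add: E_def norm_mult norm_divide)
  have inside: "\<exists>R :: real \<Rightarrow> complex. R \<in> O[at_top](\<lambda>k. of_real (1 / k)) \<and>
      (\<forall>k>0. I k = E k * (of_real \<mu> + R k))"
  proof (intro exI conjI allI impI)
    let ?R = "\<lambda>k. I k / E k - of_real \<mu>"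
    have "norm (?R k) \<le> 2 * C * norm (complex_of_real (1 / k))" if k: "k > 0" for k
    proof -
      have E0: "E k \<noteq> 0" using normE[OF k] k by auto
      have "?R k = (I k - E k * of_real \<mu>) / E k" using E0 by (simp add: field_simps)
      then have "norm (?R k) = norm (I k - E k * of_real \<mu>) * (2 * k)"
        using k by (simp add: norm_divide normE)
      also have "\<dots> \<le> C / k\<^sup>2 * (2 * k)" using C[OF k] k by (intro mult_right_mono) auto
      also have "\<dots> = 2 * C * norm (complex_of_real (1 / k))"
        using k by (simp add: power2_eq_square norm_divide)
      finally show ?thesis .
    qed
    then show "?R \<in> O[at_top](\<lambda>k. of_real (1 / k))"
      by (intro bigoI[where c = "2 * C"] eventually_mono[OF eventually_gt_at_top[of 0]])
    fix k :: real assume "k > 0"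
    then have "E k \<noteq> 0" using normE[of k] by auto
    then show "I k = E k * (of_real \<mu> + ?R k)" by simp
  qed
  have outside_decay: "I \<in> O[at_top](\<lambda>k. of_real (1 / k\<^sup>2))" if "(x, y) \<notin> disk"
  proof (rule bigoI[where c = C], rule eventually_mono[OF eventually_gt_at_top[of 0]])
    fix k :: real assume "k > 0"
    then show "norm (I k) \<le> C * norm (complex_of_real (1 / k\<^sup>2))"
      using C[of k] outside[OF that] by (simp add: \<mu>_def norm_divide norm_power)
  qed
  show ?thesis
    using integrable inside outside_decay unfolding E_def \<mu>_def \<psi>_def by blast
qed

end
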